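(* Let $\{\xi_k\}_{k\ge1}$ be a sequence of independent and identically distributed (i.i.d.) random variables under the sublinear expectation $\mathbb{E}=\sup_{P\in\Theta}E_P$. Suppose $\mathbb{E}[|\xi_1|^{1+\beta}]<\infty$ for some $\beta>0$. Set $\bar{\xi}_n=\frac{\xi_1+\cdots+\xi_n}{n}$, $\overline{\mu}=\mathbb{E}[\xi_1]$ and $\underline{\mu}=-\mathbb{E}[-\xi_1]$. Then, for any $P\in\Theta$, $$\underline{\mu}\le\liminf_{n\rightarrow\infty}\bar{\xi}_n\le\limsup_{n\rightarrow\infty}\bar{\xi}_n\le\overline{\mu},\quad P\text{-a.s.}$$
   Context: Sublinear expectation space: $(\Omega,\mathcal{F})$ is a measurable space, $\Theta$ a set of probability measures on $(\Omega,\mathcal{F})$, $\mathcal{H}$ a linear space of $\mathcal{F}$-measurable real functions $\xi$ on $\Omega$ with $\sup_{P\in\Theta}E_P[|\xi|]<\infty$, and $\mathbb{E}[\xi]=\sup_{P\in\Theta}E_P[\xi]$ for $\xi\in\mathcal{H}$; the same formula is used for other measurable functions of elements of $\mathcal{H}$ (such as bounded ones or nonnegative ones). The random variables $\xi_k$ belong to $\mathcal{H}$. $C_{b,Lip}(\mathbb{R}^n)$ denotes the bounded Lipschitz continuous functions on $\mathbb{R}^n$. A random vector $\mathbf{X}\in\mathcal{H}^m$ is independent of $\mathbf{Y}\in\mathcal{H}^n$ if for any $\varphi\in C_{b,Lip}(\mathbb{R}^{n+m})$, $\mathbb{E}[\varphi(\mathbf{Y},\mathbf{X})]=\mathbb{E}\big[\mathbb{E}[\varphi(\mathbf{y},\mathbf{X})]|_{\mathbf{y}=\mathbf{Y}}\big]$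 (this relation is not symmetric). $\mathbf{X}\overset{d}{=}\mathbf{Y}$ (identically distributed) means $\mathbb{E}[\varphi(\mathbf{X})]=\mathbb{E}[\varphi(\mathbf{Y})]$ for every bounded Lipschitz $\varphi$. A sequence $(X_i)_{i\ge1}$ is i.i.d. if, for each $i\ge1$, $X_{i+1}$ is independent of $(X_1,\dots,X_i)$ and $X_{i+1}\overset{d}{=}X_i$. *)

theory Defs
  imports "HOL-Probability.Probability"
begin

text \<open>
  For a random variable that is unbounded above in mean over \<open>\<Theta>\<close>, the real supremum below is a junk
  value. It is only applied to elements of the linear space of a sublinear expectation space and
  to bounded measurable functions. Possibly infinite expectations of nonnegative variables are
  expressed by \<open>nn_sublinear_expectation\<close>.
\<close>

definition sublinear_expectation :: "'a measure set \<Rightarrow> ('a \<Rightarrow> real) \<Rightarrow> real" where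
  "sublinear_expectation \<Theta> \<xi> = (SUP P\<in>\<Theta>. integral\<^sup>L P \<xi>)"

definition nn_sublinear_expectation :: "'a measure set \<Rightarrow> ('a \<Rightarrow> real) \<Rightarrow> ennreal" where
  "nn_sublinear_expectation \<Theta> \<xi> = (SUP P\<in>\<Theta>. \<integral>\<^sup>+ \<omega>. ennreal (\<xi> \<omega>) \<partial>P)"

locale sublinear_expectation_space =
  fixes M :: "'a measure" \<comment> \<open>only the measurable space of \<open>M\<close> matters\<close>
    and \<Theta> :: "'a measure set"
    and H :: "('a \<Rightarrow> real) set"
  assumes prob_space: "P \<in> \<Theta> \<Longrightarrow> prob_space P"
    and sets_eq: "P \<in> \<Theta> \<Longrightarrow> sets P = sets M"
    and zero_mem: "(\<lambda>\<omega>. 0) \<in> H"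
    and add_mem: "\<xi> \<in> H \<Longrightarrow> \<eta> \<in> H \<Longrightarrow> (\<lambda>\<omega>. \<xi> \<omega> + \<eta> \<omega>) \<in> H"
    and scale_mem: "\<xi> \<in> H \<Longrightarrow> (\<lambda>\<omega>. c * \<xi> \<omega>) \<in> H"
    and measurable: "\<xi> \<in> H \<Longrightarrow> \<xi> \<in> borel_measurable M"
    and finite_mean: "\<xi> \<in> H \<Longrightarrow> nn_sublinear_expectation \<Theta> (\<lambda>\<omega>. \<bar>\<xi> \<omega>\<bar>) < \<infinity>"

text \<open>
  Since the dimension varies, a point of \<open>n\<close>-dimensional Euclidean space is represented by the
  coordinates \<open>x 0, \<dots>, x (n - 1)\<close> of some \<open>x :: nat \<Rightarrow> real\<close>. The Lipschitz bound in terms of the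
  Euclidean distance of these coordinates forces \<open>\<phi>\<close> to ignore all other coordinates.
\<close>

definition bounded_lipschitz :: "nat \<Rightarrow> ((nat \<Rightarrow> real) \<Rightarrow> real) set" where
  "bounded_lipschitz n = {\<phi>. (\<exists>B. \<forall>x. \<bar>\<phi> x\<bar> \<le> B) \<and>
     (\<exists>L\<ge>0. \<forall>x y. \<bar>\<phi> x - \<phi> y\<bar> \<le> L * L2_set (\<lambda>i. x i - y i) {..<n})}"

definition append_vec :: "nat \<Rightarrow> (nat \<Rightarrow> 'b) \<Rightarrow> (nat \<Rightarrow> 'b) \<Rightarrow> nat \<Rightarrow> 'b" where
  "append_vec n y x = (\<lambda>i. if i < n then y i else x (i - n))"

text \<open>
  \<open>X\<close> (of dimension \<open>m\<close>) is independent of \<open>Y\<close> (of dimension \<open>n\<close>); the order matters. Random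
  vectors are given by their components.
\<close>

definition indep_of ::
  "'a measure set \<Rightarrow> nat \<Rightarrow> (nat \<Rightarrow> 'a \<Rightarrow> real) \<Rightarrow> nat \<Rightarrow> (nat \<Rightarrow> 'a \<Rightarrow> real) \<Rightarrow> bool" where
  "indep_of \<Theta> m X n Y \<longleftrightarrow> (\<forall>\<phi>\<in>bounded_lipschitz (n + m).
     sublinear_expectation \<Theta> (\<lambda>\<omega>. \<phi> (append_vec n (\<lambda>i. Y i \<omega>) (\<lambda>i. X i \<omega>))) =
     sublinear_expectation \<Theta> (\<lambda>\<omega>.
       sublinear_expectation \<Theta> (\<lambda>\<omega>'. \<phi> (append_vec n (\<lambda>i. Y i \<omega>) (\<lambda>i. X i \<omega>')))))"

definition ident_distr ::
  "'a measure set \<Rightarrow> nat \<Rightarrow> (nat \<Rightarrow> 'a \<Rightarrow> real) \<Rightarrow> (nat \<Rightarrow> 'a \<Rightarrow> real) \<Rightarrow> bool" where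
  "ident_distr \<Theta> m X Y \<longleftrightarrow> (\<forall>\<phi>\<in>bounded_lipschitz m.
     sublinear_expectation \<Theta> (\<lambda>\<omega>. \<phi> (\<lambda>i. X i \<omega>)) =
     sublinear_expectation \<Theta> (\<lambda>\<omega>. \<phi> (\<lambda>i. Y i \<omega>)))"

text \<open>
  The sequence starts at index 1; \<open>\<xi> 0\<close> is irrelevant. A random variable \<open>\<xi> k\<close> is the
  one-dimensional vector \<open>\<lambda>_. \<xi> k\<close>, and \<open>\<lambda>j. \<xi> (Suc j)\<close> in dimension \<open>i\<close> is \<open>(\<xi> 1, \<dots>, \<xi> i)\<close>.
\<close>

definition iid_seq :: "'a measure set \<Rightarrow> (nat \<Rightarrow> 'a \<Rightarrow> real) \<Rightarrow> bool" where
  "iid_seq \<Theta> \<xi> \<longleftrightarrow> (\<forall>i\<ge>1.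
     indep_of \<Theta> 1 (\<lambda>_. \<xi> (Suc i)) i (\<lambda>j. \<xi> (Suc j)) \<and>
     ident_distr \<Theta> 1 (\<lambda>_. \<xi> (Suc i)) (\<lambda>_. \<xi> i))"

end

theory Submission
  imports Defs "HOL-Real_Asymp.Real_Asymp"
begin

text \<open>
  Applying the independence condition to the test function \<open>exp (f (x\<^sub>1) + \<dots> + f (x\<^sub>n))\<close> shows that
  exponential moments of sums are multiplicative under a sublinear expectation, just as in the
  classical case: a nonnegative factor that depends on the past can be pulled out of the inner
  expectation (\<open>sublinear_expectation_exp_sum\<close>). So the classical exponential method gives tail
  bounds that hold for every \<open>P \<in> \<Theta>\<close>, although the variables need not be independent under \<open>P\<close>.

  The variables have only a moment of order \<open>1 + \<beta>\<close>, where \<open>\<beta> \<le> 1\<close> may be assumed, so they are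
  truncated at a level \<open>b\<close> before the exponential is taken. With the exponent scaled by \<open>1 / b\<close>, the
  scaled variables lie between \<open>-1\<close> and \<open>1\<close>, and the cost of the truncation and the quadratic term of
  the exponential are together at most \<open>b powr (- \<beta>) * \<bar>x\<bar> powr (1 + \<beta>)\<close> (\<open>clip_plus_square_le\<close>).
  Hence the probability that the truncated sum reaches \<open>n (\<mu> + \<epsilon>)\<close>, where \<open>\<mu>\<close> is the upper mean, is at
  most \<open>exp (- n (\<epsilon> - C b powr (- \<beta>)) / b)\<close> (\<open>prob_clip_sum_ge\<close>).

  With \<open>b = n powr \<gamma>\<close> these bounds are summable in \<open>n\<close> when \<open>\<gamma> < 1\<close>, and almost surely the
  truncation changes only finitely many of the sums when \<open>\<gamma> (1 + \<beta>) > 1\<close>; both are instances of the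
  Borel--Cantelli lemma, and both conditions on \<open>\<gamma>\<close> can be met at once because \<open>\<beta> > 0\<close>. This proves
  the upper bound; the lower bound is the upper bound for the sequence of the negated variables.
\<close>

section \<open>Truncation and elementary inequalities\<close>

definition clip :: "real \<Rightarrow> real \<Rightarrow> real" where
  "clip b x = max (- b) (min b x)"

lemma abs_clip_le: "b \<ge> 0 \<Longrightarrow> \<bar>clip b x\<bar> \<le> b"
  by (auto simp: clip_def)

lemma clip_lipschitz: "\<bar>clip b x - clip b y\<bar> \<le> \<bar>x - y\<bar>"
  by (auto simp: clip_def max_def min_def)

lemma clip_eq: "\<bar>x\<bar> \<le> b \<Longrightarrow> clip b x = x"
  by (auto simp: clip_def)

lemma borel_measurable_clip [measurable]: "clip b \<in> borel_measurable borel"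
  unfolding clip_def by measurable

lemma exp_le_quadratic:
  fixes x :: real
  assumes "\<bar>x\<bar> \<le> 1"
  shows "exp x \<le> 1 + x + x\<^sup>2"
proof (cases "x \<ge> 0")
  case True
  then show ?thesis using exp_bound[of x] assms by auto
next
  case False
  have "1 \<le> (1 + x + x\<^sup>2) * (1 - x)"
  proof -
    have "(1 + x + x\<^sup>2) * (1 - x) = 1 + x\<^sup>2 * (- x)"
      by (simp add: algebra_simps power2_eq_square)
    moreover have "x\<^sup>2 * (- x) \<ge> 0" using False by (intro mult_nonneg_nonneg) auto
    ultimately show ?thesis by linarith
  qed
  also have "\<dots> \<le> (1 + x + x\<^sup>2) * exp (- x)"
  proof (rule mult_left_mono)
    show "1 - x \<le> exp (- x)" using exp_ge_add_one_self[of "- x"] by simp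
    show "0 \<le> 1 + x + x\<^sup>2" using assms by (simp add: add_nonneg_nonneg)
  qed
  finally have "1 * exp x \<le> (1 + x + x\<^sup>2) * exp (- x) * exp x"
    by (rule mult_right_mono) simp
  then show ?thesis by (simp add: mult.assoc flip: exp_add)
qed

text \<open>
  The square is that of \<open>m = min b \<bar>x\<bar>\<close>. In \<open>m\<^sup>2 = m powr (1 - \<beta>) * m powr (1 + \<beta>)\<close> the first factor is
  estimated by \<open>m \<le> b\<close>, which needs \<open>1 - \<beta>\<close> to be nonnegative, and the second one by \<open>m \<le> \<bar>x\<bar>\<close>.
\<close>

lemma clip_square_le:
  assumes "0 < b" "0 < \<beta>" "\<beta> \<le> 1"
  shows "(clip b x)\<^sup>2 \<le> b powr (1 - \<beta>) * \<bar>x\<bar> powr (1 + \<beta>)"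
proof (cases "x = 0")
  case True
  then show ?thesis using assms by (simp add: clip_def)
next
  case False
  define m where "m = min b \<bar>x\<bar>"
  have m: "0 < m" "m \<le> b" "m \<le> \<bar>x\<bar>" using False assms by (auto simp: m_def)
  have "\<bar>clip b x\<bar> = m" using assms by (auto simp: clip_def m_def)
  then have "(clip b x)\<^sup>2 = m\<^sup>2" by (metis power2_abs)
  also have "\<dots> = m powr (1 - \<beta>) * m powr (1 + \<beta>)"
    using m by (simp flip: powr_add add: powr_numeral)
  also have "\<dots> \<le> b powr (1 - \<beta>) * \<bar>x\<bar> powr (1 + \<beta>)"
    using m assms by (intro mult_mono powr_mono2) auto
  finally show ?thesis .
qed

text \<open>
  Inside the interval from \<open>- b\<close> to \<open>b\<close> only the square costs something, and \<open>clip_square_le\<close> bounds it.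
  Outside, the truncation error \<open>\<bar>x\<bar> - b\<close> and the square divided by \<open>b\<close>, which is \<open>b\<close>, add up to \<open>\<bar>x\<bar>\<close>,
  and there \<open>1 \<le> (\<bar>x\<bar> / b) powr \<beta>\<close>.
\<close>

lemma clip_plus_square_le:
  assumes "0 < b" "0 < \<beta>" "\<beta> \<le> 1"
  shows "clip b x + (clip b x)\<^sup>2 / b \<le> x + b powr (- \<beta>) * \<bar>x\<bar> powr (1 + \<beta>)"
proof (cases "\<bar>x\<bar> \<le> b")
  case True
  have "(clip b x)\<^sup>2 / b \<le> b powr (1 - \<beta>) * \<bar>x\<bar> powr (1 + \<beta>) / b"
    using clip_square_le[OF assms] assms(1) by (intro divide_right_mono) auto
  also have "b powr (1 - \<beta>) * \<bar>x\<bar> powr (1 + \<beta>) / b = b powr (- \<beta>) * \<bar>x\<bar> powr (1 + \<beta>)"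
    using assms(1) by (simp add: powr_diff powr_minus field_simps)
  finally show ?thesis using True by (simp add: clip_eq)
next
  case False
  have "\<bar>x\<bar> * 1 \<le> \<bar>x\<bar> * (b powr (- \<beta>) * \<bar>x\<bar> powr \<beta>)"
  proof (rule mult_left_mono)
    have "b powr (- \<beta>) * b powr \<beta> \<le> b powr (- \<beta>) * \<bar>x\<bar> powr \<beta>"
      using assms False by (intro mult_left_mono powr_mono2) auto
    then show "1 \<le> b powr (- \<beta>) * \<bar>x\<bar> powr \<beta>"
      using assms by (simp flip: powr_add)
  qed simp
  also have "\<dots> = b powr (- \<beta>) * \<bar>x\<bar> powr (1 + \<beta>)"
    using False assms by (simp add: powr_add)
  finally have "\<bar>x\<bar> \<le> b powr (- \<beta>) * \<bar>x\<bar> powr (1 + \<beta>)" by simp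
  moreover have "(clip b x)\<^sup>2 / b = b"
  proof -
    have "\<bar>clip b x\<bar> = b" using False assms by (auto simp: clip_def)
    then have "(clip b x)\<^sup>2 = b\<^sup>2" by (metis power2_abs)
    then show ?thesis by (simp add: power2_eq_square)
  qed
  moreover have "clip b x + b \<le> x + \<bar>x\<bar>"
    using False assms by (auto simp: clip_def)
  ultimately show ?thesis by linarith
qed

section \<open>Bounded Lipschitz functions of several variables\<close>

lemma abs_nth_le_L2_set:
  fixes x :: "nat \<Rightarrow> real"
  assumes "i < n"
  shows "\<bar>x i\<bar> \<le> L2_set x {..<n}"
proof -
  have "(x i)\<^sup>2 \<le> (\<Sum>i<n. (x i)\<^sup>2)" using assms by (intro member_le_sum) auto
  then show ?thesis unfolding L2_set_def by (intro real_le_rsqrt) simp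
qed

lemma abs_exp_diff_le:
  fixes x y :: real
  assumes "x \<le> K" "y \<le> K"
  shows "\<bar>exp x - exp y\<bar> \<le> exp K * \<bar>x - y\<bar>"
proof -
  have *: "exp v - exp u \<le> exp K * (v - u)" if "u \<le> v" "v \<le> K" for u v :: real
  proof -
    have "exp v * (1 - exp (u - v)) \<le> exp v * (v - u)"
    proof (rule mult_left_mono)
      show "1 - exp (u - v) \<le> v - u" using exp_ge_add_one_self[of "u - v"] by linarith
    qed simp
    also have "\<dots> \<le> exp K * (v - u)" using that by (intro mult_right_mono) auto
    finally show ?thesis by (simp add: algebra_simps flip: exp_add)
  qed
  show ?thesis using *[of x y] *[of y x] assms by (cases "x \<le> y") auto
qed

lemma exp_sum_bounded_lipschitz:
  assumes f_bdd: "\<And>x. \<bar>f x\<bar> \<le> B"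
    and f_lip: "\<And>x y. \<bar>f x - f y\<bar> \<le> L * \<bar>x - y\<bar>"
  shows "(\<lambda>z. exp (\<Sum>j<n. f (z j))) \<in> bounded_lipschitz n"
proof -
  have L: "L \<ge> 0" using f_lip[of 1 0] by auto
  have sum_bdd: "(\<Sum>j<n. f (z j)) \<le> real n * B" for z
    using sum_mono[of "{..<n}" "\<lambda>j. f (z j)" "\<lambda>_. B"] f_bdd by (simp add: abs_le_iff)
  have "\<bar>exp (\<Sum>j<n. f (x j)) - exp (\<Sum>j<n. f (y j))\<bar>
      \<le> exp (real n * B) * (real n * L) * L2_set (\<lambda>i. x i - y i) {..<n}" for x y
  proof -
    have "\<bar>(\<Sum>j<n. f (x j)) - (\<Sum>j<n. f (y j))\<bar> \<le> (\<Sum>j<n. \<bar>f (x j) - f (y j)\<bar>)"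
      by (metis sum_abs sum_subtractf)
    also have "\<dots> \<le> (\<Sum>j<n. L * L2_set (\<lambda>i. x i - y i) {..<n})"
    proof (rule sum_mono)
      fix j assume "j \<in> {..<n}"
      then have "L * \<bar>x j - y j\<bar> \<le> L * L2_set (\<lambda>i. x i - y i) {..<n}"
        using abs_nth_le_L2_set[of j n "\<lambda>i. x i - y i"] L by (intro mult_left_mono) auto
      then show "\<bar>f (x j) - f (y j)\<bar> \<le> L * L2_set (\<lambda>i. x i - y i) {..<n}"
        using f_lip[of "x j" "y j"] by linarith
    qed
    finally have "\<bar>(\<Sum>j<n. f (x j)) - (\<Sum>j<n. f (y j))\<bar>
        \<le> real n * L * L2_set (\<lambda>i. x i - y i) {..<n}" by simp
    then have "exp (real n * B) * \<bar>(\<Sum>j<n. f (x j)) - (\<Sum>j<n. f (y j))\<bar>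
        \<le> exp (real n * B) * (real n * L * L2_set (\<lambda>i. x i - y i) {..<n})"
      by (intro mult_left_mono) auto
    with abs_exp_diff_le[OF sum_bdd[of x] sum_bdd[of y]] show ?thesis
      unfolding mult.assoc by (rule order_trans)
  qed
  moreover have "\<bar>exp (\<Sum>j<n. f (z j))\<bar> \<le> exp (real n * B)" for z
    using sum_bdd by simp
  moreover have "exp (real n * B) * (real n * L) \<ge> 0" using L by simp
  ultimately show ?thesis unfolding bounded_lipschitz_def by blast
qed

lemma bounded_lipschitz_1I:
  assumes "\<And>x. \<bar>f x\<bar> \<le> B" and "\<And>x y. \<bar>f x - f y\<bar> \<le> L * \<bar>x - y\<bar>"
  shows "(\<lambda>z. f (z 0)) \<in> bounded_lipschitz 1"
proof -
  have "L \<ge> 0" using assms(2)[of 1 0] by auto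
  moreover have "\<bar>f (x 0) - f (y 0)\<bar> \<le> L * L2_set (\<lambda>i. x i - y i) {..<1}"
    for x y :: "nat \<Rightarrow> real"
    using assms(2)[of "x 0" "y 0"] by (simp add: L2_set_def)
  ultimately show ?thesis using assms(1) unfolding bounded_lipschitz_def by blast
qed

lemma bounded_lipschitz_uminus:
  assumes "\<phi> \<in> bounded_lipschitz n"
  shows "(\<lambda>z. \<phi> (\<lambda>i. - z i)) \<in> bounded_lipschitz n"
proof -
  obtain B L where B: "\<And>x. \<bar>\<phi> x\<bar> \<le> B" and L: "L \<ge> 0"
    "\<And>x y. \<bar>\<phi> x - \<phi> y\<bar> \<le> L * L2_set (\<lambda>i. x i - y i) {..<n}"
    using assms unfolding bounded_lipschitz_def by blast
  have "\<bar>\<phi> (\<lambda>i. - x i) - \<phi> (\<lambda>i. - y i)\<bar> \<le> L * L2_set (\<lambda>i. x i - y i) {..<n}" for x y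
    using L(2)[of "\<lambda>i. - x i" "\<lambda>i. - y i"] by (simp add: L2_set_def power2_commute)
  then show ?thesis using B L(1) unfolding bounded_lipschitz_def by blast
qed

lemma iid_seq_uminus:
  assumes "iid_seq \<Theta> \<xi>"
  shows "iid_seq \<Theta> (\<lambda>k \<omega>. - \<xi> k \<omega>)"
proof -
  have append: "append_vec n (\<lambda>i. - y i) (\<lambda>i. - x i) = (\<lambda>i. - append_vec n y x i)"
    for n and x y :: "nat \<Rightarrow> real"
    by (auto simp: append_vec_def)
  show ?thesis
    unfolding iid_seq_def
  proof (intro allI impI conjI)
    fix i :: nat assume i: "i \<ge> 1"
    have "indep_of \<Theta> 1 (\<lambda>_. \<xi> (Suc i)) i (\<lambda>j. \<xi> (Suc j))"
      and ident: "ident_distr \<Theta> 1 (\<lambda>_. \<xi> (Suc i)) (\<lambda>_. \<xi> i)"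
      using assms i unfolding iid_seq_def by auto
    then show "indep_of \<Theta> 1 (\<lambda>_ \<omega>. - \<xi> (Suc i) \<omega>) i (\<lambda>j \<omega>. - \<xi> (Suc j) \<omega>)"
      unfolding indep_of_def append by (auto dest: bounded_lipschitz_uminus)
    show "ident_distr \<Theta> 1 (\<lambda>_ \<omega>. - \<xi> (Suc i) \<omega>) (\<lambda>_ \<omega>. - \<xi> i \<omega>)"
      using ident unfolding ident_distr_def by (auto dest: bounded_lipschitz_uminus)
  qed
qed

lemma iid_seq_ident:
  assumes "iid_seq \<Theta> \<xi>" and "k \<ge> 1" and "g \<in> bounded_lipschitz 1"
  shows "sublinear_expectation \<Theta> (\<lambda>\<omega>. g (\<lambda>_. \<xi> k \<omega>)) =
    sublinear_expectation \<Theta> (\<lambda>\<omega>. g (\<lambda>_. \<xi> 1 \<omega>))"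
  using assms(2)
proof (induction k rule: dec_induct)
  case (step i)
  then show ?case using assms unfolding iid_seq_def ident_distr_def by auto
qed simp

section \<open>Basic properties of the sublinear expectation\<close>

lemma sublinear_expectation_least:
  assumes "\<Theta> \<noteq> {}" and "\<And>P. P \<in> \<Theta> \<Longrightarrow> integral\<^sup>L P X \<le> c"
  shows "sublinear_expectation \<Theta> X \<le> c"
  unfolding sublinear_expectation_def using assms by (intro cSUP_least) auto

text \<open>
  The bound excludes the case in which the real supremum has no meaning.
\<close>

lemma sublinear_expectation_mult_left:
  assumes ne: "\<Theta> \<noteq> {}" and c: "c \<ge> 0"
    and bdd: "bdd_above ((\<lambda>P. integral\<^sup>L P X) ` \<Theta>)"
  shows "sublinear_expectation \<Theta> (\<lambda>\<omega>. c * X \<omega>) = c * sublinear_expectation \<Theta> X"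
proof -
  have "mono (\<lambda>x::real. c * x)" using c by (auto intro: monoI mult_left_mono)
  moreover have "continuous (at_left (Sup ((\<lambda>P. integral\<^sup>L P X) ` \<Theta>))) (\<lambda>x::real. c * x)"
    by (intro continuous_intros)
  ultimately have "c * Sup ((\<lambda>P. integral\<^sup>L P X) ` \<Theta>)
      = (SUP x\<in>(\<lambda>P. integral\<^sup>L P X) ` \<Theta>. c * x)"
    using continuous_at_Sup_mono[of "\<lambda>x. c * x" "(\<lambda>P. integral\<^sup>L P X) ` \<Theta>"] ne bdd by auto
  then show ?thesis
    unfolding sublinear_expectation_def by (simp add: image_image)
qed

context sublinear_expectation_space
begin

lemma expectation_bounded:
  fixes X :: "'a \<Rightarrow> real"
  assumes "P \<in> \<Theta>" and "\<And>\<omega>. \<bar>X \<omega>\<bar> \<le> B"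
  shows "\<bar>integral\<^sup>L P X\<bar> \<le> B"
proof -
  interpret prob_space P by (rule prob_space[OF assms(1)])
  have "B \<ge> 0" using order_trans[OF abs_ge_zero assms(2)] .
  show ?thesis
  proof (cases "integrable P X")
    case True
    have "\<bar>integral\<^sup>L P X\<bar> \<le> (\<integral>\<omega>. \<bar>X \<omega>\<bar> \<partial>P)" by (rule integral_abs_bound)
    also have "\<dots> \<le> B" using True assms(2) by (intro integral_le_const) auto
    finally show ?thesis .
  next
    case False
    then show ?thesis using \<open>B \<ge> 0\<close> by (simp add: not_integrable_integral_eq)
  qed
qed

lemma bdd_above_bounded:
  fixes X :: "'a \<Rightarrow> real"
  assumes "\<And>\<omega>. \<bar>X \<omega>\<bar> \<le> B"
  shows "bdd_above ((\<lambda>P. integral\<^sup>L P X) ` \<Theta>)"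
  using expectation_bounded[OF _ assms] by (intro bdd_aboveI2[of _ _ B]) (auto simp: abs_le_iff)

lemma expectation_le:
  assumes "P \<in> \<Theta>" and "\<And>\<omega>. \<bar>X \<omega>\<bar> \<le> B"
  shows "integral\<^sup>L P X \<le> sublinear_expectation \<Theta> X"
  unfolding sublinear_expectation_def
  using assms(1) bdd_above_bounded[OF assms(2)] by (intro cSUP_upper)

lemma borel_measurable_H:
  assumes "P \<in> \<Theta>" and "X \<in> H"
  shows "X \<in> borel_measurable P"
  using measurable[OF assms(2)] sets_eq[OF assms(1)] by (simp cong: measurable_cong_sets)

lemma integrable_H:
  assumes "P \<in> \<Theta>" and "X \<in> H"
  shows "integrable P X"
proof -
  have "(\<integral>\<^sup>+ \<omega>. ennreal \<bar>X \<omega>\<bar> \<partial>P) \<le> nn_sublinear_expectation \<Theta> (\<lambda>\<omega>. \<bar>X \<omega>\<bar>)"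
    unfolding nn_sublinear_expectation_def using assms(1) by (intro SUP_upper)
  also have "\<dots> < \<infinity>" by (rule finite_mean[OF assms(2)])
  finally show ?thesis
    using borel_measurable_H[OF assms] by (simp add: integrable_iff_bounded)
qed

lemma nn_expectation_bound:
  assumes "nn_sublinear_expectation \<Theta> X < \<infinity>"
  obtains C where "C \<ge> 0" "\<And>P. P \<in> \<Theta> \<Longrightarrow> (\<integral>\<^sup>+ \<omega>. ennreal (X \<omega>) \<partial>P) \<le> ennreal C"
proof -
  obtain C where C: "C \<ge> 0" "nn_sublinear_expectation \<Theta> X = ennreal C"
    using assms by (cases "nn_sublinear_expectation \<Theta> X") auto
  have "(\<integral>\<^sup>+ \<omega>. ennreal (X \<omega>) \<partial>P) \<le> ennreal C" if "P \<in> \<Theta>" for P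
    unfolding C(2)[symmetric] nn_sublinear_expectation_def using that by (intro SUP_upper)
  with C(1) that show ?thesis by blast
qed

lemma expectation_le_H:
  assumes "P \<in> \<Theta>" and "X \<in> H"
  shows "integral\<^sup>L P X \<le> sublinear_expectation \<Theta> X"
proof -
  obtain C where C: "C \<ge> 0" "\<And>P. P \<in> \<Theta> \<Longrightarrow> (\<integral>\<^sup>+ \<omega>. ennreal \<bar>X \<omega>\<bar> \<partial>P) \<le> ennreal C"
    using nn_expectation_bound[OF finite_mean[OF assms(2)]] by blast
  have "integral\<^sup>L Q X \<le> C" if "Q \<in> \<Theta>" for Q
  proof -
    note int = integrable_H[OF that assms(2)]
    have "integral\<^sup>L Q X \<le> (\<integral>\<omega>. \<bar>X \<omega>\<bar> \<partial>Q)" using int by (intro integral_mono) auto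
    also have "\<dots> \<le> C"
      using int C(2)[OF that] C(1) by (simp add: nn_integral_eq_integral)
    finally show ?thesis .
  qed
  then have "bdd_above ((\<lambda>P. integral\<^sup>L P X) ` \<Theta>)" by (intro bdd_aboveI2[of _ _ C])
  then show ?thesis unfolding sublinear_expectation_def using assms(1) by (intro cSUP_upper)
qed

lemma uminus_mem: "X \<in> H \<Longrightarrow> (\<lambda>\<omega>. - X \<omega>) \<in> H"
  using scale_mem[of X "- 1"] by simp

section \<open>Exponential moments of sums and a Chernoff bound\<close>

text \<open>
  The exponential of a sum of \<open>n + 1\<close> terms is the product of a positive function of the first \<open>n\<close>
  variables and a function of the last one. The inner expectation in the definition of independence
  replaces the second factor by a constant \<open>c \<ge> 0\<close>, and this constant leaves the outer expectation by
  positive homogeneity. The boundedness and the Lipschitz condition on \<open>f\<close> make the exponential an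
  admissible test function.
\<close>

lemma sublinear_expectation_exp_sum:
  assumes iid: "iid_seq \<Theta> \<xi>" and ne: "\<Theta> \<noteq> {}" and n: "n \<ge> 1"
    and f_bdd: "\<And>x. \<bar>f x\<bar> \<le> B"
    and f_lip: "\<And>x y. \<bar>f x - f y\<bar> \<le> L * \<bar>x - y\<bar>"
  shows "sublinear_expectation \<Theta> (\<lambda>\<omega>. exp (\<Sum>k=1..n. f (\<xi> k \<omega>))) =
    sublinear_expectation \<Theta> (\<lambda>\<omega>. exp (f (\<xi> 1 \<omega>))) ^ n"
  using n
proof (induction n rule: dec_induct)
  case base
  then show ?case by simp
next
  case (step n)
  define c where "c = sublinear_expectation \<Theta> (\<lambda>\<omega>. exp (f (\<xi> 1 \<omega>)))"
  define \<phi> where "\<phi> z = exp (\<Sum>j<n + 1. f (z j))" for z :: "nat \<Rightarrow> real"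
  define S where "S \<omega> = (\<Sum>k=1..n. f (\<xi> k \<omega>))" for \<omega>
  have exp_f_bdd: "\<bar>exp (f x)\<bar> \<le> exp B" for x using f_bdd[of x] by (simp add: abs_le_iff)
  have S_bdd: "\<bar>exp (S \<omega>)\<bar> \<le> exp (real n * B)" for \<omega>
    using sum_mono[of "{1..n}" "\<lambda>k. f (\<xi> k \<omega>)" "\<lambda>_. B"] f_bdd
    by (simp add: S_def abs_le_iff)
  have \<phi>_append: "\<phi> (append_vec n (\<lambda>i. \<xi> (Suc i) \<omega>) (\<lambda>i. x)) = exp (S \<omega>) * exp (f x)" for \<omega> x
    by (simp add: \<phi>_def S_def append_vec_def exp_add sum.atLeast1_atMost_eq)
  obtain P where "P \<in> \<Theta>" using ne by blast
  have "c \<ge> integral\<^sup>L P (\<lambda>\<omega>. exp (f (\<xi> 1 \<omega>)))"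
    unfolding c_def by (rule expectation_le[OF \<open>P \<in> \<Theta>\<close>]) (rule exp_f_bdd)
  moreover have "integral\<^sup>L P (\<lambda>\<omega>. exp (f (\<xi> 1 \<omega>))) \<ge> 0" by (rule Bochner_Integration.integral_nonneg) simp
  ultimately have c_nonneg: "c \<ge> 0" by linarith
  have ident: "sublinear_expectation \<Theta> (\<lambda>\<omega>. exp (f (\<xi> (Suc n) \<omega>))) = c"
    using iid_seq_ident[OF iid, of "Suc n" "\<lambda>z. exp (\<Sum>j<1. f (z j))"]
      exp_sum_bounded_lipschitz[OF f_bdd f_lip, of 1] by (simp add: c_def)
  have "\<phi> \<in> bounded_lipschitz (n + 1)"
    unfolding \<phi>_def by (rule exp_sum_bounded_lipschitz[OF f_bdd f_lip])
  moreover have "indep_of \<Theta> 1 (\<lambda>_. \<xi> (Suc n)) n (\<lambda>j. \<xi> (Suc j))"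
    using iid step.hyps unfolding iid_seq_def by auto
  ultimately have "sublinear_expectation \<Theta> (\<lambda>\<omega>. exp (S \<omega>) * exp (f (\<xi> (Suc n) \<omega>))) =
      sublinear_expectation \<Theta> (\<lambda>\<omega>. sublinear_expectation \<Theta> (\<lambda>\<omega>'. exp (S \<omega>) * exp (f (\<xi> (Suc n) \<omega>'))))"
    unfolding indep_of_def \<phi>_append[symmetric] by blast
  also have "\<dots> = sublinear_expectation \<Theta> (\<lambda>\<omega>. c * exp (S \<omega>))"
    by (subst sublinear_expectation_mult_left[OF ne _ bdd_above_bounded[OF exp_f_bdd]])
       (simp_all add: ident mult.commute)
  also have "\<dots> = c * sublinear_expectation \<Theta> (\<lambda>\<omega>. exp (S \<omega>))"
    by (rule sublinear_expectation_mult_left[OF ne c_nonneg bdd_above_bounded[OF S_bdd]])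
  finally show ?case
    using step.IH by (simp add: S_def c_def exp_add)
qed

text \<open>
  The inequality \<open>exp y \<le> 1 + y + y\<^sup>2\<close> at \<open>y = clip b x / b\<close>, which is at most 1 in absolute value,
  reduces the exponential moment to \<open>clip_plus_square_le\<close>; this is why the exponent is scaled by \<open>1 / b\<close>.
\<close>

lemma sublinear_expectation_exp_clip_le:
  assumes X: "X \<in> H" and ne: "\<Theta> \<noteq> {}" and b: "0 < b" and \<beta>: "0 < \<beta>" "\<beta> \<le> 1"
    and moment: "\<And>P. P \<in> \<Theta> \<Longrightarrow> (\<integral>\<^sup>+ \<omega>. ennreal (\<bar>X \<omega>\<bar> powr (1 + \<beta>)) \<partial>P) \<le> ennreal C" "C \<ge> 0"
  shows "sublinear_expectation \<Theta> (\<lambda>\<omega>. exp (clip b (X \<omega>) / b))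
    \<le> exp ((sublinear_expectation \<Theta> X + b powr (- \<beta>) * C) / b)"
proof (rule sublinear_expectation_least[OF ne])
  fix P assume P: "P \<in> \<Theta>"
  interpret prob_space P by (rule prob_space[OF P])
  note [measurable] = borel_measurable_H[OF P X]
  let ?m = "\<lambda>\<omega>. \<bar>X \<omega>\<bar> powr (1 + \<beta>)"
  have int_m: "integrable P ?m"
    using moment(1)[OF P] by (intro integrableI_bounded) (auto intro: le_less_trans)
  have m_le: "(\<integral>\<omega>. ?m \<omega> \<partial>P) \<le> C"
    using moment(1)[OF P] moment(2) int_m by (simp add: nn_integral_eq_integral)
  have pointwise: "exp (clip b x / b) \<le> 1 + (x + b powr (- \<beta>) * \<bar>x\<bar> powr (1 + \<beta>)) / b" for x
  proof -
    have "exp (clip b x / b) \<le> 1 + clip b x / b + (clip b x / b)\<^sup>2"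
      using abs_clip_le[of b x] b by (intro exp_le_quadratic) auto
    also have "\<dots> = 1 + (clip b x + (clip b x)\<^sup>2 / b) / b"
      using b by (simp add: power2_eq_square field_simps)
    also have "\<dots> \<le> 1 + (x + b powr (- \<beta>) * \<bar>x\<bar> powr (1 + \<beta>)) / b"
      using clip_plus_square_le[OF b \<beta>] b by (intro add_left_mono divide_right_mono) auto
    finally show ?thesis .
  qed
  have "(\<integral>\<omega>. exp (clip b (X \<omega>) / b) \<partial>P)
      \<le> (\<integral>\<omega>. 1 + (X \<omega> + b powr (- \<beta>) * ?m \<omega>) / b \<partial>P)"
  proof (rule integral_mono)
    show "integrable P (\<lambda>\<omega>. exp (clip b (X \<omega>) / b))"
      by (rule integrable_const_bound[of _ "exp 1"])
         (use b abs_clip_le[of b] in \<open>auto simp: abs_le_iff\<close>)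
    show "integrable P (\<lambda>\<omega>. 1 + (X \<omega> + b powr (- \<beta>) * ?m \<omega>) / b)"
      using int_m integrable_H[OF P X] by auto
  qed (rule pointwise)
  also have "\<dots> = 1 + (integral\<^sup>L P X + b powr (- \<beta>) * (\<integral>\<omega>. ?m \<omega> \<partial>P)) / b"
    using int_m integrable_H[OF P X] by (simp add: prob_space)
  also have "\<dots> \<le> 1 + (sublinear_expectation \<Theta> X + b powr (- \<beta>) * C) / b"
    using expectation_le_H[OF P X] m_le b
    by (intro add_left_mono divide_right_mono add_mono mult_left_mono) auto
  also have "\<dots> \<le> exp ((sublinear_expectation \<Theta> X + b powr (- \<beta>) * C) / b)"
    by (rule exp_ge_add_one_self)
  finally show "(\<integral>\<omega>. exp (clip b (X \<omega>) / b) \<partial>P) \<le> \<dots>" .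
qed

text \<open>
  Chernoff's method: Markov's inequality under \<open>P\<close> for the exponential of the sum divided by \<open>b\<close>.
  The variables may be dependent under \<open>P\<close>, but the expectation under \<open>P\<close> is dominated by the sublinear
  one, which factorises.
\<close>

lemma prob_clip_sum_ge:
  assumes H: "\<And>k. k \<ge> 1 \<Longrightarrow> \<xi> k \<in> H" and iid: "iid_seq \<Theta> \<xi>" and P: "P \<in> \<Theta>"
    and n: "n \<ge> 1" and b: "0 < b" and \<beta>: "0 < \<beta>" "\<beta> \<le> 1"
    and moment: "\<And>Q. Q \<in> \<Theta> \<Longrightarrow> (\<integral>\<^sup>+ \<omega>. ennreal (\<bar>\<xi> 1 \<omega>\<bar> powr (1 + \<beta>)) \<partial>Q) \<le> ennreal C" "C \<ge> 0"
  shows "measure P {\<omega>\<in>space P. (\<Sum>k=1..n. clip b (\<xi> k \<omega>)) \<ge> real n * a}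
    \<le> exp (real n * (sublinear_expectation \<Theta> (\<xi> 1) + b powr (- \<beta>) * C - a) / b)"
proof -
  interpret prob_space P by (rule prob_space[OF P])
  have ne: "\<Theta> \<noteq> {}" using P by blast
  have meas [measurable]: "\<xi> k \<in> borel_measurable P" if "k \<in> {1..n}" for k
    using that borel_measurable_H[OF P H] by simp
  let ?S = "\<lambda>\<omega>. (\<Sum>k=1..n. clip b (\<xi> k \<omega>) / b)"
  let ?\<mu> = "sublinear_expectation \<Theta> (\<xi> 1)"
  have clip_div_bdd: "\<bar>clip b x / b\<bar> \<le> 1" for x using abs_clip_le[of b x] b by simp
  have clip_div_lip: "\<bar>clip b x / b - clip b y / b\<bar> \<le> (1 / b) * \<bar>x - y\<bar>" for x y
    using clip_lipschitz[of b x y] b by (simp add: divide_right_mono flip: diff_divide_distrib)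
  have S_bdd: "\<bar>exp (?S \<omega>)\<bar> \<le> exp (real n)" for \<omega>
  proof -
    have "?S \<omega> \<le> (\<Sum>k=1..n. 1)" by (rule sum_mono) (rule abs_le_D1[OF clip_div_bdd])
    then show ?thesis by simp
  qed
  have int: "integrable P (\<lambda>\<omega>. exp (?S \<omega>))"
    by (rule integrable_const_bound[of _ "exp (real n)"]) (use S_bdd in auto)
  have "measure P {\<omega>\<in>space P. (\<Sum>k=1..n. clip b (\<xi> k \<omega>)) \<ge> real n * a}
      = measure P {\<omega>\<in>space P. exp (?S \<omega>) \<ge> exp (real n * a / b)}"
    using b by (simp add: divide_le_cancel flip: sum_divide_distrib)
  also have "\<dots> \<le> (\<integral>\<omega>. exp (?S \<omega>) \<partial>P) / exp (real n * a / b)"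
    using int by (intro integral_Markov_inequality_measure[where A="{}"]) auto
  also have "(\<integral>\<omega>. exp (?S \<omega>) \<partial>P) \<le> sublinear_expectation \<Theta> (\<lambda>\<omega>. exp (?S \<omega>))"
    by (rule expectation_le[OF P S_bdd])
  also have "\<dots> = sublinear_expectation \<Theta> (\<lambda>\<omega>. exp (clip b (\<xi> 1 \<omega>) / b)) ^ n"
    by (rule sublinear_expectation_exp_sum[OF iid ne n clip_div_bdd clip_div_lip])
  also have "\<dots> \<le> exp ((?\<mu> + b powr (- \<beta>) * C) / b) ^ n"
  proof (rule power_mono)
    show "sublinear_expectation \<Theta> (\<lambda>\<omega>. exp (clip b (\<xi> 1 \<omega>) / b)) \<le> exp ((?\<mu> + b powr (- \<beta>) * C) / b)"
      by (rule sublinear_expectation_exp_clip_le[OF H ne b \<beta> moment]) auto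
    have "0 \<le> (\<integral>\<omega>. exp (clip b (\<xi> 1 \<omega>) / b) \<partial>P)" by simp
    also have "\<dots> \<le> sublinear_expectation \<Theta> (\<lambda>\<omega>. exp (clip b (\<xi> 1 \<omega>) / b))"
      by (rule expectation_le[OF P, of _ "exp 1"]) (use abs_le_D1[OF clip_div_bdd] in simp)
    finally show "0 \<le> sublinear_expectation \<Theta> (\<lambda>\<omega>. exp (clip b (\<xi> 1 \<omega>) / b))" .
  qed
  also have "exp ((?\<mu> + b powr (- \<beta>) * C) / b) ^ n / exp (real n * a / b)
      = exp (real n * (?\<mu> + b powr (- \<beta>) * C - a) / b)"
    by (simp add: exp_diff[symmetric] algebra_simps diff_divide_distrib add_divide_distrib
        flip: exp_of_nat_mult)
  finally show ?thesis by (simp add: divide_right_mono)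
qed

text \<open>
  Equality in distribution speaks only of bounded Lipschitz functions, so the moment bound on \<open>\<xi> 1\<close>
  has to be carried over to \<open>\<xi> k\<close> by such a function. The square of \<open>clip b x / b\<close> serves: it lies above
  the indicator of \<open>\<bar>x\<bar> \<ge> b\<close> and, by \<open>clip_square_le\<close>, below \<open>(\<bar>x\<bar> / b) powr (1 + \<beta>)\<close>.
\<close>

lemma prob_abs_ge:
  assumes H: "\<And>k. k \<ge> 1 \<Longrightarrow> \<xi> k \<in> H" and iid: "iid_seq \<Theta> \<xi>" and P: "P \<in> \<Theta>"
    and k: "k \<ge> 1" and b: "0 < b" and \<beta>: "0 < \<beta>" "\<beta> \<le> 1"
    and moment: "\<And>Q. Q \<in> \<Theta> \<Longrightarrow> (\<integral>\<^sup>+ \<omega>. ennreal (\<bar>\<xi> 1 \<omega>\<bar> powr (1 + \<beta>)) \<partial>Q) \<le> ennreal C" "C \<ge> 0"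
  shows "measure P {\<omega>\<in>space P. \<bar>\<xi> k \<omega>\<bar> \<ge> b} \<le> C * b powr (- (1 + \<beta>))"
proof -
  note all_prob_space = prob_space
  interpret prob_space P by (rule prob_space[OF P])
  have ne: "\<Theta> \<noteq> {}" using P by blast
  have [measurable]: "\<xi> k \<in> borel_measurable P" using borel_measurable_H[OF P H[OF k]] .
  define g where "g x = (clip b x / b)\<^sup>2" for x
  have clip_div_bdd: "\<bar>clip b x / b\<bar> \<le> 1" for x using abs_clip_le[of b x] b by simp
  have g_bdd: "\<bar>g x\<bar> \<le> 1" for x
    using clip_div_bdd[of x] by (simp add: g_def abs_square_le_1 del: power_divide)
  have g_lip: "\<bar>g x - g y\<bar> \<le> (2 / b) * \<bar>x - y\<bar>" for x y
  proof -
    have "\<bar>g x - g y\<bar> = \<bar>clip b x / b + clip b y / b\<bar> * \<bar>clip b x / b - clip b y / b\<bar>"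
      unfolding g_def abs_mult[symmetric] by (simp add: power2_eq_square algebra_simps)
    also have "\<dots> \<le> 2 * (\<bar>x - y\<bar> / b)"
    proof (rule mult_mono)
      show "\<bar>clip b x / b + clip b y / b\<bar> \<le> 2"
        using clip_div_bdd[of x] clip_div_bdd[of y] by linarith
      show "\<bar>clip b x / b - clip b y / b\<bar> \<le> \<bar>x - y\<bar> / b"
        using clip_lipschitz[of b x y] b by (simp add: divide_right_mono flip: diff_divide_distrib)
    qed auto
    finally show ?thesis by simp
  qed
  have [measurable]: "g \<in> borel_measurable borel" unfolding g_def by measurable
  have "measure P {\<omega>\<in>space P. \<bar>\<xi> k \<omega>\<bar> \<ge> b} \<le> measure P {\<omega>\<in>space P. g (\<xi> k \<omega>) \<ge> 1}"
  proof (rule finite_measure_mono)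
    have "g x \<ge> 1" if "\<bar>x\<bar> \<ge> b" for x
    proof -
      have "\<bar>clip b x / b\<bar> = 1" using that b by (auto simp: clip_def)
      then have "(clip b x / b)\<^sup>2 = 1" by (metis power2_abs one_power2)
      then show ?thesis by (simp add: g_def)
    qed
    then show "{\<omega>\<in>space P. \<bar>\<xi> k \<omega>\<bar> \<ge> b} \<subseteq> {\<omega>\<in>space P. g (\<xi> k \<omega>) \<ge> 1}" by auto
  qed measurable
  also have "\<dots> \<le> (\<integral>\<omega>. g (\<xi> k \<omega>) \<partial>P) / 1"
  proof (rule integral_Markov_inequality_measure[where A="{}"])
    show "integrable P (\<lambda>\<omega>. g (\<xi> k \<omega>))"
      by (rule integrable_const_bound[of _ 1]) (use g_bdd in auto)
  qed (auto simp: g_def)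
  also have "\<dots> \<le> sublinear_expectation \<Theta> (\<lambda>\<omega>. g (\<xi> k \<omega>))"
    using expectation_le[OF P, of "\<lambda>\<omega>. g (\<xi> k \<omega>)" 1] g_bdd by simp
  also have "\<dots> = sublinear_expectation \<Theta> (\<lambda>\<omega>. g (\<xi> 1 \<omega>))"
    using iid_seq_ident[OF iid k bounded_lipschitz_1I[OF g_bdd g_lip]] .
  also have "\<dots> \<le> C * b powr (- (1 + \<beta>))"
  proof (rule sublinear_expectation_least[OF ne])
    fix Q assume Q: "Q \<in> \<Theta>"
    interpret Q: prob_space Q by (rule all_prob_space[OF Q])
    have [measurable]: "\<xi> (Suc 0) \<in> borel_measurable Q" using borel_measurable_H[OF Q H[of 1]] by simp
    let ?m = "\<lambda>\<omega>. \<bar>\<xi> 1 \<omega>\<bar> powr (1 + \<beta>)"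
    have int_m: "integrable Q ?m"
      using moment(1)[OF Q] by (intro integrableI_bounded) (auto intro: le_less_trans)
    have m_le: "(\<integral>\<omega>. ?m \<omega> \<partial>Q) \<le> C"
      using moment(1)[OF Q] moment(2) int_m by (simp add: nn_integral_eq_integral)
    have "g x \<le> b powr (- (1 + \<beta>)) * \<bar>x\<bar> powr (1 + \<beta>)" for x
    proof -
      have "g x \<le> b powr (1 - \<beta>) * \<bar>x\<bar> powr (1 + \<beta>) / b\<^sup>2"
        unfolding g_def power_divide using clip_square_le[OF b \<beta>] by (intro divide_right_mono) auto
      also have "\<dots> = b powr (1 - \<beta> - 2) * \<bar>x\<bar> powr (1 + \<beta>)"
        using powr_diff[of b "1 - \<beta>" 2] b by (simp add: powr_numeral)
      finally show ?thesis by (simp add: algebra_simps)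
    qed
    then have "(\<integral>\<omega>. g (\<xi> 1 \<omega>) \<partial>Q) \<le> (\<integral>\<omega>. b powr (- (1 + \<beta>)) * ?m \<omega> \<partial>Q)"
      using int_m g_bdd
      by (intro integral_mono Q.integrable_const_bound[of "\<lambda>\<omega>. g (\<xi> 1 \<omega>)" 1]) auto
    also have "\<dots> \<le> b powr (- (1 + \<beta>)) * C"
      using m_le by (simp add: mult_left_mono)
    finally show "(\<integral>\<omega>. g (\<xi> 1 \<omega>) \<partial>Q) \<le> C * b powr (- (1 + \<beta>))" by (simp add: mult.commute)
  qed
  finally show ?thesis .
qed

section \<open>The strong law of large numbers\<close>

text \<open>
  By Borel--Cantelli, \<open>\<bar>\<xi> k\<bar> < k powr \<gamma>\<close> for all but finitely many \<open>k\<close>. For these \<open>k\<close> the larger level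
  \<open>n powr \<gamma>\<close> with \<open>n \<ge> k\<close> does not truncate either, and the finitely many exceptions lie below
  \<open>n powr \<gamma>\<close> once \<open>n\<close> is large.
\<close>

lemma AE_eventually_sum_clip_eq:
  assumes H: "\<And>k. k \<ge> 1 \<Longrightarrow> \<xi> k \<in> H" and iid: "iid_seq \<Theta> \<xi>" and P: "P \<in> \<Theta>"
    and \<beta>: "0 < \<beta>" "\<beta> \<le> 1" and \<gamma>: "0 < \<gamma>" "\<gamma> * (1 + \<beta>) > 1"
    and moment: "\<And>Q. Q \<in> \<Theta> \<Longrightarrow> (\<integral>\<^sup>+ \<omega>. ennreal (\<bar>\<xi> 1 \<omega>\<bar> powr (1 + \<beta>)) \<partial>Q) \<le> ennreal C" "C \<ge> 0"
  shows "AE \<omega> in P. \<forall>\<^sub>F n in sequentially.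
    (\<Sum>k=1..n. clip (real n powr \<gamma>) (\<xi> k \<omega>)) = (\<Sum>k=1..n. \<xi> k \<omega>)"
proof -
  interpret prob_space P by (rule prob_space[OF P])
  have [measurable]: "\<xi> (Suc k) \<in> borel_measurable P" for k using borel_measurable_H[OF P H] by simp
  define A where "A k = {\<omega>\<in>space P. \<bar>\<xi> (Suc k) \<omega>\<bar> \<ge> real (Suc k) powr \<gamma>}" for k
  have "summable (\<lambda>k. C * real (Suc k) powr (- \<gamma> * (1 + \<beta>)))"
    using \<gamma>(2) summable_real_powr_iff[of "- \<gamma> * (1 + \<beta>)"]
    by (intro summable_mult) (subst summable_Suc_iff, simp)
  then have "summable (\<lambda>k. measure P (A k))"
  proof (rule summable_comparison_test'[where N=0])
    fix k
    have "measure P (A k) \<le> C * (real (Suc k) powr \<gamma>) powr (- (1 + \<beta>))"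
      unfolding A_def by (rule prob_abs_ge[OF H iid P _ _ \<beta> moment]) auto
    then show "norm (measure P (A k)) \<le> C * real (Suc k) powr (- \<gamma> * (1 + \<beta>))"
      by (simp only: powr_powr) (simp add: algebra_simps)
  qed
  then have "AE \<omega> in P. \<forall>\<^sub>F k in sequentially. \<omega> \<in> space P - A k"
    by (intro borel_cantelli_AE1) (auto simp: A_def emeasure_eq_measure)
  then show ?thesis
  proof eventually_elim
    case (elim \<omega>)
    then obtain K where K: "\<And>k. k \<ge> K \<Longrightarrow> \<bar>\<xi> (Suc k) \<omega>\<bar> \<le> real (Suc k) powr \<gamma>"
      unfolding eventually_sequentially A_def by force
    \<comment> \<open>a common bound for the finitely many terms not controlled by \<open>K\<close>\<close>
    define D where "D = (\<Sum>k=1..K. \<bar>\<xi> k \<omega>\<bar>)"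
    have "filterlim (\<lambda>n. real n powr \<gamma>) at_top sequentially" using \<gamma>(1) by real_asymp
    then have "\<forall>\<^sub>F n in sequentially. D \<le> real n powr \<gamma>" by (simp add: filterlim_at_top)
    then show ?case
    proof eventually_elim
      case (elim n)
      show ?case
      proof (rule sum.cong[OF refl], rule clip_eq)
        fix k assume k: "k \<in> {1..n}"
        show "\<bar>\<xi> k \<omega>\<bar> \<le> real n powr \<gamma>"
        proof (cases "k \<le> K")
          case True
          then have "\<bar>\<xi> k \<omega>\<bar> \<le> D" unfolding D_def using k by (intro member_le_sum) auto
          then show ?thesis using elim by linarith
        next
          case False
          then have "\<bar>\<xi> k \<omega>\<bar> \<le> real k powr \<gamma>" using K[of "k - 1"] k by simp
          also have "\<dots> \<le> real n powr \<gamma>" using k \<gamma>(1) by (intro powr_mono2) auto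
          finally show ?thesis .
        qed
      qed
    qed
  qed
qed

text \<open>
  At the level \<open>b = n powr \<gamma>\<close> the correction \<open>C b powr (- \<beta>)\<close> tends to 0 and is eventually absorbed by
  half of \<open>\<epsilon>\<close>. The Chernoff bound becomes \<open>exp (- (\<epsilon> / 2) n powr (1 - \<gamma>))\<close>, which is summable.
\<close>

lemma AE_eventually_sum_clip_less:
  assumes H: "\<And>k. k \<ge> 1 \<Longrightarrow> \<xi> k \<in> H" and iid: "iid_seq \<Theta> \<xi>" and P: "P \<in> \<Theta>"
    and \<beta>: "0 < \<beta>" "\<beta> \<le> 1" and \<gamma>: "0 < \<gamma>" "\<gamma> < 1" and \<epsilon>: "\<epsilon> > 0"
    and moment: "\<And>Q. Q \<in> \<Theta> \<Longrightarrow> (\<integral>\<^sup>+ \<omega>. ennreal (\<bar>\<xi> 1 \<omega>\<bar> powr (1 + \<beta>)) \<partial>Q) \<le> ennreal C" "C \<ge> 0"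
  shows "AE \<omega> in P. \<forall>\<^sub>F n in sequentially.
    (\<Sum>k=1..n. clip (real n powr \<gamma>) (\<xi> k \<omega>)) < real n * (sublinear_expectation \<Theta> (\<xi> 1) + \<epsilon>)"
proof -
  interpret prob_space P by (rule prob_space[OF P])
  let ?\<mu> = "sublinear_expectation \<Theta> (\<xi> 1)"
  have meas: "\<xi> k \<in> borel_measurable P" if "k \<in> {1..n}" for k n
    using that borel_measurable_H[OF P H] by simp
  define A where "A n = {\<omega>\<in>space P.
    (\<Sum>k=1..n. clip (real n powr \<gamma>) (\<xi> k \<omega>)) \<ge> real n * (?\<mu> + \<epsilon>)}" for n
  have sets_A: "A n \<in> sets P" for n
    unfolding A_def using meas[of _ n] by measurable
  have "(\<lambda>n. (real n powr \<gamma>) powr (- \<beta>) * C) \<longlonglongrightarrow> 0"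
    using \<gamma>(1) \<beta>(1) by real_asymp
  then have "\<forall>\<^sub>F n in sequentially. (real n powr \<gamma>) powr (- \<beta>) * C < \<epsilon> / 2"
    using \<epsilon> by (intro order_tendstoD(2)) auto
  then obtain N where N: "\<And>n. n \<ge> N \<Longrightarrow> (real n powr \<gamma>) powr (- \<beta>) * C < \<epsilon> / 2"
    unfolding eventually_sequentially by blast
  have "(\<lambda>n. exp (- (\<epsilon> / 2) * real n powr (1 - \<gamma>))) \<in> O(\<lambda>n. real n powr (-2))"
    using \<gamma> \<epsilon> by real_asymp
  then have "summable (\<lambda>n. exp (- (\<epsilon> / 2) * real n powr (1 - \<gamma>)))"
    by (rule summable_comparison_test_bigo[rotated]) (simp add: summable_real_powr_iff)
  then have "summable (\<lambda>n. measure P (A n))"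
  proof (rule summable_comparison_test'[where N="max N 1"])
    fix n assume n: "n \<ge> max N 1"
    let ?b = "real n powr \<gamma>"
    have b: "?b > 0" using n by simp
    have "measure P (A n) \<le> exp (real n * (?\<mu> + ?b powr (- \<beta>) * C - (?\<mu> + \<epsilon>)) / ?b)"
      unfolding A_def by (rule prob_clip_sum_ge[OF H iid P _ b \<beta> moment]) (use n in auto)
    also have "\<dots> \<le> exp (real n * (- (\<epsilon> / 2)) / ?b)"
    proof -
      have "real n * (?\<mu> + ?b powr (- \<beta>) * C - (?\<mu> + \<epsilon>)) / ?b \<le> real n * (- (\<epsilon> / 2)) / ?b"
        using N[of n] n b by (intro divide_right_mono mult_left_mono) auto
      then show ?thesis by simp
    qed
    also have "real n * (- (\<epsilon> / 2)) / ?b = - (\<epsilon> / 2) * real n powr (1 - \<gamma>)"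
      using n by (simp add: powr_diff)
    finally show "norm (measure P (A n)) \<le> exp (- (\<epsilon> / 2) * real n powr (1 - \<gamma>))"
      by simp
  qed
  then have "AE \<omega> in P. \<forall>\<^sub>F n in sequentially. \<omega> \<in> space P - A n"
    by (intro borel_cantelli_AE1 sets_A) (auto simp: emeasure_eq_measure)
  then show ?thesis
    by eventually_elim (auto simp: A_def not_le elim: eventually_mono)
qed

lemma AE_limsup_average_le:
  assumes H: "\<And>k. k \<ge> 1 \<Longrightarrow> \<xi> k \<in> H" and iid: "iid_seq \<Theta> \<xi>" and P: "P \<in> \<Theta>" and \<beta>: "\<beta> > 0"
    and moment: "nn_sublinear_expectation \<Theta> (\<lambda>\<omega>. \<bar>\<xi> 1 \<omega>\<bar> powr (1 + \<beta>)) < \<infinity>"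
  shows "AE \<omega> in P. limsup (\<lambda>n. ereal ((\<Sum>k=1..n. \<xi> k \<omega>) / real n))
    \<le> ereal (sublinear_expectation \<Theta> (\<xi> 1))"
proof -
  let ?\<mu> = "sublinear_expectation \<Theta> (\<xi> 1)"
  \<comment> \<open>The estimates for truncated variables need an exponent of at most 1; a smaller moment is finite too.\<close>
  define \<alpha> where "\<alpha> = min \<beta> 1"
  have \<alpha>: "0 < \<alpha>" "\<alpha> \<le> 1" using \<beta> by (auto simp: \<alpha>_def)
  \<comment> \<open>any number strictly between \<open>1 / (1 + \<alpha>)\<close> and 1\<close>
  define \<gamma> where "\<gamma> = 1 / (1 + \<alpha> / 2)"
  have \<gamma>: "0 < \<gamma>" "\<gamma> < 1" "\<gamma> * (1 + \<alpha>) > 1" using \<alpha> by (auto simp: \<gamma>_def field_simps)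
  obtain C where C: "C \<ge> 0"
    "\<And>Q. Q \<in> \<Theta> \<Longrightarrow> (\<integral>\<^sup>+ \<omega>. ennreal (\<bar>\<xi> 1 \<omega>\<bar> powr (1 + \<beta>)) \<partial>Q) \<le> ennreal C"
    using nn_expectation_bound[OF moment] by blast
  have moment': "(\<integral>\<^sup>+ \<omega>. ennreal (\<bar>\<xi> 1 \<omega>\<bar> powr (1 + \<alpha>)) \<partial>Q) \<le> ennreal (1 + C)" if Q: "Q \<in> \<Theta>" for Q
  proof -
    interpret Q: prob_space Q by (rule prob_space[OF Q])
    have [measurable]: "\<xi> (Suc 0) \<in> borel_measurable Q" using borel_measurable_H[OF Q H[of 1]] by simp
    have pointwise: "\<bar>x\<bar> powr (1 + \<alpha>) \<le> 1 + \<bar>x\<bar> powr (1 + \<beta>)" for x :: real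
    proof (cases "\<bar>x\<bar> \<le> 1")
      case True
      then have "\<bar>x\<bar> powr (1 + \<alpha>) \<le> 1" using \<alpha> by (intro powr_le1) auto
      then show ?thesis by (simp add: add_increasing2)
    next
      case False
      then have "\<bar>x\<bar> powr (1 + \<alpha>) \<le> \<bar>x\<bar> powr (1 + \<beta>)" by (intro powr_mono) (auto simp: \<alpha>_def)
      then show ?thesis by simp
    qed
    have "(\<integral>\<^sup>+ \<omega>. ennreal (\<bar>\<xi> 1 \<omega>\<bar> powr (1 + \<alpha>)) \<partial>Q)
        \<le> (\<integral>\<^sup>+ \<omega>. 1 + ennreal (\<bar>\<xi> 1 \<omega>\<bar> powr (1 + \<beta>)) \<partial>Q)"
      by (intro nn_integral_mono)
         (metis pointwise ennreal_leI ennreal_plus ennreal_1 powr_ge_zero zero_le_one)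
    also have "\<dots> = 1 + (\<integral>\<^sup>+ \<omega>. ennreal (\<bar>\<xi> 1 \<omega>\<bar> powr (1 + \<beta>)) \<partial>Q)"
      by (subst nn_integral_add) (auto simp: Q.emeasure_space_1)
    also have "\<dots> \<le> 1 + ennreal C" using C(2)[OF Q] by (rule add_left_mono)
    also have "\<dots> = ennreal (1 + C)" using C(1) by simp
    finally show ?thesis .
  qed
  have C': "1 + C \<ge> 0" using C(1) by simp
  have "AE \<omega> in P. \<forall>i. \<forall>\<^sub>F n in sequentially.
      (\<Sum>k=1..n. clip (real n powr \<gamma>) (\<xi> k \<omega>)) < real n * (?\<mu> + 1 / real (Suc i))"
    unfolding AE_all_countable
    using AE_eventually_sum_clip_less[OF H iid P \<alpha> \<gamma>(1,2) _ moment' C'] by simp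
  moreover have "AE \<omega> in P. \<forall>\<^sub>F n in sequentially.
      (\<Sum>k=1..n. clip (real n powr \<gamma>) (\<xi> k \<omega>)) = (\<Sum>k=1..n. \<xi> k \<omega>)"
    using AE_eventually_sum_clip_eq[OF H iid P \<alpha> \<gamma>(1,3) moment' C'] .
  ultimately show ?thesis
  proof eventually_elim
    case (elim \<omega>)
    let ?L = "limsup (\<lambda>n. ereal ((\<Sum>k=1..n. \<xi> k \<omega>) / real n))"
    have L_le: "?L \<le> ereal (?\<mu> + 1 / real (Suc i))" for i
    proof (rule Limsup_bounded)
      have "\<forall>\<^sub>F n in sequentially.
        (\<Sum>k=1..n. clip (real n powr \<gamma>) (\<xi> k \<omega>)) < real n * (?\<mu> + 1 / real (Suc i))"
        using elim(1) by blast
      with elim(2) eventually_gt_at_top[of 0]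
      show "\<forall>\<^sub>F n in sequentially. ereal ((\<Sum>k=1..n. \<xi> k \<omega>) / real n) \<le> ereal (?\<mu> + 1 / real (Suc i))"
        by eventually_elim (simp add: divide_le_eq mult.commute less_imp_le)
    qed
    have "(\<lambda>i. ereal (?\<mu> + 1 / real (Suc i))) \<longlonglongrightarrow> ereal ?\<mu>"
      unfolding lim_ereal using tendsto_add[OF tendsto_const LIMSEQ_inverse_real_of_nat, of ?\<mu>]
      by (simp add: divide_inverse)
    then show "?L \<le> ereal ?\<mu>" by (rule LIMSEQ_le_const) (use L_le in blast)
  qed
qed

end

theorem theorem3p1:
  fixes M :: "'a measure"
    and \<Theta> :: "'a measure set"
    and H :: "('a \<Rightarrow> real) set"
    and \<xi> :: "nat \<Rightarrow> 'a \<Rightarrow> real"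
    and \<beta> :: real
    and P :: "'a measure"
  assumes "sublinear_expectation_space M \<Theta> H"
    and "\<And>k. k \<ge> 1 \<Longrightarrow> \<xi> k \<in> H"
    and "iid_seq \<Theta> \<xi>"
    and "\<beta> > 0"
    and "nn_sublinear_expectation \<Theta> (\<lambda>\<omega>. \<bar>\<xi> 1 \<omega>\<bar> powr (1 + \<beta>)) < \<infinity>"
    and "P \<in> \<Theta>"
  shows "AE \<omega> in P.
    ereal (- sublinear_expectation \<Theta> (\<lambda>\<omega>. - \<xi> 1 \<omega>))
      \<le> liminf (\<lambda>n. ereal ((\<Sum>k=1..n. \<xi> k \<omega>) / real n)) \<and>
    liminf (\<lambda>n. ereal ((\<Sum>k=1..n. \<xi> k \<omega>) / real n))
      \<le> limsup (\<lambda>n. ereal ((\<Sum>k=1..n. \<xi> k \<omega>) / real n)) \<and>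
    limsup (\<lambda>n. ereal ((\<Sum>k=1..n. \<xi> k \<omega>) / real n))
      \<le> ereal (sublinear_expectation \<Theta> (\<xi> 1))"
proof -
  interpret sublinear_expectation_space M \<Theta> H by fact
  have "AE \<omega> in P. limsup (\<lambda>n. ereal ((\<Sum>k=1..n. \<xi> k \<omega>) / real n))
      \<le> ereal (sublinear_expectation \<Theta> (\<xi> 1))"
    by (rule AE_limsup_average_le[OF assms(2,3,6,4,5)])
  moreover have "AE \<omega> in P. limsup (\<lambda>n. ereal ((\<Sum>k=1..n. - \<xi> k \<omega>) / real n))
      \<le> ereal (sublinear_expectation \<Theta> (\<lambda>\<omega>. - \<xi> 1 \<omega>))"
    by (rule AE_limsup_average_le[OF _ iid_seq_uminus[OF assms(3)] assms(6,4)])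
       (use assms(2,5) uminus_mem in auto)
  ultimately show ?thesis
  proof eventually_elim
    case (elim \<omega>)
    let ?avg = "\<lambda>n. ereal ((\<Sum>k=1..n. \<xi> k \<omega>) / real n)"
    have "(\<lambda>n. ereal ((\<Sum>k=1..n. - \<xi> k \<omega>) / real n)) = (\<lambda>n. - ?avg n)"
      by (simp add: sum_negf)
    then have "- liminf ?avg \<le> ereal (sublinear_expectation \<Theta> (\<lambda>\<omega>. - \<xi> 1 \<omega>))"
      using elim(2) by (simp only: ereal_Limsup_uminus)
    then have "ereal (- sublinear_expectation \<Theta> (\<lambda>\<omega>. - \<xi> 1 \<omega>)) \<le> liminf ?avg"
      using ereal_uminus_le_reorder by (metis uminus_ereal.simps(1))
    moreover have "liminf ?avg \<le> limsup ?avg" by (rule Liminf_le_Limsup) simp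
    ultimately show ?case using elim(1) by blast
  qed
qed

end
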